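(* Let $\lambda=(1^{a_1},2^{a_2},\ldots,n^{a_n})\vdash n$. Then \[\mathbb{E}_{\lambda}[\operatorname{exc}]=\frac{1}{2}(n-a_1)=\mathbb{E}_\lambda[\operatorname{aexc}] \quad\text{and}\quad \mathbb{E}_\lambda[\widetilde{\operatorname{exc}}]=\frac{1}{2}(n+a_1).\]
   Context: For $\omega\in S_n$: an excedance is an index $i\in[n]$ with $\omega(i)>i$, a weak excedance is an index with $\omega(i)\ge i$, and an anti-excedance is an index with $\omega(i)<i$. $\operatorname{exc}(\omega)$, $\widetilde{\operatorname{exc}}(\omega)$, $\operatorname{aexc}(\omega)$ denote the numbers of excedances, weak excedances and anti-excedances respectively. The partition $\lambda$ has $a_i$ parts equal to $i$; $\mathbb{E}_\lambda$ denotes expectation under the uniform measure on the conjugacy class $C_\lambda$ of $S_n$ of cycle type $\lambda$. *)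

theory Defs
  imports
    "HOL-Combinatorics.Orbits"
    "HOL-Probability.Probability_Mass_Function"
begin

text \<open>
  A permutation of \<open>[n]\<close> is a function \<open>\<omega> :: nat \<Rightarrow> nat\<close> with \<open>\<omega> permutes {1..n}\<close>; such a
  function fixes every number outside \<open>{1..n}\<close>, so the index range is always explicit below.
\<close>

definition exc :: "nat \<Rightarrow> (nat \<Rightarrow> nat) \<Rightarrow> nat" where
  "exc n \<omega> = card {i \<in> {1..n}. \<omega> i > i}"

definition wexc :: "nat \<Rightarrow> (nat \<Rightarrow> nat) \<Rightarrow> nat" where
  "wexc n \<omega> = card {i \<in> {1..n}. \<omega> i \<ge> i}"

definition aexc :: "nat \<Rightarrow> (nat \<Rightarrow> nat) \<Rightarrow> nat" where
  "aexc n \<omega> = card {i \<in> {1..n}. \<omega> i < i}"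

text \<open>
  A partition is the multiset of its parts; in the notation \<open>(1^a\<^sub>1, \<dots>, n^a\<^sub>n)\<close> the
  multiplicity \<open>a\<^sub>i\<close> is \<open>count \<lambda> i\<close>.
\<close>

definition is_partition :: "nat multiset \<Rightarrow> nat \<Rightarrow> bool"  (infix \<open>\<turnstile>\<^sub>p\<close> 50) where
  "lam \<turnstile>\<^sub>p n \<longleftrightarrow> (\<forall>i \<in># lam. i > 0) \<and> sum_mset lam = n"

text \<open>
  The orbits of \<open>\<omega>\<close> on \<open>{1..n}\<close>, fixed points included, are the supports of its cycles. They
  form a set, so each cycle contributes exactly one part, namely its length.
\<close>

definition cycle_type :: "nat \<Rightarrow> (nat \<Rightarrow> nat) \<Rightarrow> nat multiset" where
  "cycle_type n \<omega> = image_mset card (mset_set (orbit \<omega> ` {1..n}))"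

definition conj_class :: "nat \<Rightarrow> nat multiset \<Rightarrow> (nat \<Rightarrow> nat) set" where
  "conj_class n lam = {\<omega>. \<omega> permutes {1..n} \<and> cycle_type n \<omega> = lam}"

text \<open>
  \<^const>\<open>pmf_of_set\<close> is the uniform distribution only on a finite nonempty set; \<open>conj_class n lam\<close>
  is one whenever \<open>lam\<close> is a partition of \<open>n\<close>.
\<close>

definition expect_class :: "nat \<Rightarrow> nat multiset \<Rightarrow> ((nat \<Rightarrow> nat) \<Rightarrow> nat) \<Rightarrow> real" where
  "expect_class n lam X = measure_pmf.expectation (pmf_of_set (conj_class n lam)) (\<lambda>\<omega>. real (X \<omega>))"

end

theory Submission
  imports Defs
begin

text \<open>
  Inversion maps every conjugacy class bijectively to itself and exchanges excedances with
  anti-excedances, so both have the same expectation. The remaining indices are the fixed points,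
  that is, the cycles of length one, and their number is constant on the class.
\<close>

text \<open>The map \<open>\<omega>\<close> itself is the bijection: with
  \<open>i = \<omega> j\<close> one has \<open>inv \<omega> i = j\<close>, so
  \<open>\<omega> j < j\<close> turns into \<open>i < inv \<omega> i\<close>.\<close>

lemma exc_inv:
  assumes "\<omega> permutes {1..n}"
  shows "exc n (inv \<omega>) = aexc n \<omega>"
proof -
  have "bij_betw \<omega> {j \<in> {1..n}. \<omega> j < j} {i \<in> {1..n}. inv \<omega> i > i}"
  proof (rule bij_betw_imageI)
    show "inj_on \<omega> {j \<in> {1..n}. \<omega> j < j}"
      using permutes_inj_on[OF assms] by (rule inj_on_subset) auto
    show "\<omega> ` {j \<in> {1..n}. \<omega> j < j} = {i \<in> {1..n}. inv \<omega> i > i}"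
    proof (intro equalityI subsetI)
      fix i assume "i \<in> \<omega> ` {j \<in> {1..n}. \<omega> j < j}"
      then show "i \<in> {i \<in> {1..n}. inv \<omega> i > i}"
        using permutes_in_image[OF assms] permutes_inverses(2)[OF assms] by auto
    next
      fix i assume i: "i \<in> {i \<in> {1..n}. inv \<omega> i > i}"
      then have "inv \<omega> i \<in> {j \<in> {1..n}. \<omega> j < j}" "i = \<omega> (inv \<omega> i)"
        using permutes_in_image[OF permutes_inv[OF assms], of i] permutes_inverses(1)[OF assms]
        by auto
      then show "i \<in> \<omega> ` {j \<in> {1..n}. \<omega> j < j}" by blast
    qed
  qed
  then show ?thesis unfolding exc_def aexc_def by (simp add: bij_betw_same_card)
qed

lemma finite_conj_class: "finite (conj_class n lam)"
  unfolding conj_class_def by (rule finite_subset[OF _ finite_permutations[of "{1..n}"]]) auto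

lemma permutes_interval_permutation: "\<omega> permutes {1..n::nat} \<Longrightarrow> permutation \<omega>"
  by (auto simp: permutation_permutes)

text \<open>Running through a cycle backwards visits the same points, and the cycle type is computed
  from the orbits as sets only.\<close>

lemma inv_in_conj_class:
  assumes "\<omega> \<in> conj_class n lam"
  shows "inv \<omega> \<in> conj_class n lam"
proof -
  have p: "\<omega> permutes {1..n}" and t: "cycle_type n \<omega> = lam"
    using assms by (auto simp: conj_class_def)
  have "orbit (inv \<omega>) = orbit \<omega>"
    using orbit_inv_eq[OF permutes_interval_permutation[OF p]] by auto
  then show ?thesis
    using t permutes_inv[OF p] by (simp add: conj_class_def cycle_type_def)
qed

lemma sum_exc_eq_sum_aexc:
  "(\<Sum>\<omega>\<in>conj_class n lam. exc n \<omega>) = (\<Sum>\<omega>\<in>conj_class n lam. aexc n \<omega>)"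
proof (rule sum.reindex_bij_witness[of _ inv inv])
  fix \<omega> assume "\<omega> \<in> conj_class n lam"
  then have p: "\<omega> permutes {1..n}" by (simp add: conj_class_def)
  show "inv (inv \<omega>) = \<omega>" "inv (inv \<omega>) = \<omega>" by (simp_all add: permutes_inv_inv[OF p])
  show "aexc n (inv \<omega>) = exc n \<omega>"
    using exc_inv[OF permutes_inv[OF p]] by (simp add: permutes_inv_inv[OF p])
qed (auto intro: inv_in_conj_class)

text \<open>Every point of a permutation lies in its own orbit, so a one-element orbit is
  \<open>{i}\<close> with \<open>i\<close> fixed. Sending a fixed point to its singleton is
  injective, hence counting orbits of size one counts fixed points.\<close>

lemma count_cycle_type_one:
  assumes "\<omega> permutes {1..n}"
  shows "count (cycle_type n \<omega>) 1 = card {i \<in> {1..n}. \<omega> i = i}"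
proof -
  have self: "i \<in> orbit \<omega> i" for i
    by (rule permutation_self_in_orbit[OF permutes_interval_permutation[OF assms]])
  have fixed: "orbit \<omega> i = {i}" if "card (orbit \<omega> i) = 1" for i
    using self[of i] that by (metis card_1_singletonE singletonD)
  have "count (cycle_type n \<omega>) 1 = card {B \<in> orbit \<omega> ` {1..n}. card B = 1}"
    unfolding cycle_type_def
    by (simp add: count_image_mset sum.If_cases vimage_def Int_def conj_commute)
  also have "{B \<in> orbit \<omega> ` {1..n}. card B = 1} = (\<lambda>i. {i}) ` {i \<in> {1..n}. \<omega> i = i}"
  proof (intro equalityI subsetI)
    fix B assume "B \<in> {B \<in> orbit \<omega> ` {1..n}. card B = 1}"
    then obtain i where i: "i \<in> {1..n}" "B = orbit \<omega> i" "card (orbit \<omega> i) = 1" by auto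
    have "\<omega> i \<in> orbit \<omega> i" by (rule orbit.base)
    with fixed[OF i(3)] i show "B \<in> (\<lambda>i. {i}) ` {i \<in> {1..n}. \<omega> i = i}" by auto
  next
    fix B assume "B \<in> (\<lambda>i. {i}) ` {i \<in> {1..n}. \<omega> i = i}"
    then obtain i where i: "i \<in> {1..n}" "\<omega> i = i" "B = {i}" by auto
    have "orbit \<omega> i = {i}" using i(2) by (simp add: orbit_eq_singleton_iff)
    then show "B \<in> {B \<in> orbit \<omega> ` {1..n}. card B = 1}" using i by auto
  qed
  finally show ?thesis by (simp add: card_image)
qed

lemma exc_aexc_fixed:
  "exc n \<omega> + aexc n \<omega> + card {i \<in> {1..n}. \<omega> i = i} = n"
  "wexc n \<omega> = exc n \<omega> + card {i \<in> {1..n}. \<omega> i = i}"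
proof -
  let ?E = "{i \<in> {1..n}. \<omega> i > i}" and ?A = "{i \<in> {1..n}. \<omega> i < i}"
    and ?F = "{i \<in> {1..n}. \<omega> i = i}"
  have "card {1..n} = card ((?E \<union> ?A) \<union> ?F)" by (rule arg_cong[of _ _ card]) auto
  also have "\<dots> = card ?E + card ?A + card ?F" by (subst card_Un_disjoint; auto)+
  finally show "exc n \<omega> + aexc n \<omega> + card ?F = n" by (simp add: exc_def aexc_def)
  have "wexc n \<omega> = card (?E \<union> ?F)" unfolding wexc_def by (rule arg_cong[of _ _ card]) auto
  also have "\<dots> = card ?E + card ?F" by (subst card_Un_disjoint; auto)
  finally show "wexc n \<omega> = exc n \<omega> + card ?F" by (simp add: exc_def)
qed

text \<open>Computes the orbit of the cyclic shift on a block of \<open>k\<close> consecutive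
  numbers, the cycle that is adjoined when a permutation of given cycle type is built.\<close>

lemma orbit_shift_interval:
  fixes m k i :: nat
  assumes step: "\<And>j. m < j \<Longrightarrow> j < m + k \<Longrightarrow> f j = Suc j"
    and wrap: "f (m + k) = Suc m" and i: "m < i" "i \<le> m + k"
  shows "orbit f i = {m<..m + k}"
proof
  show "orbit f i \<subseteq> {m<..m + k}"
  proof
    fix x assume "x \<in> orbit f i"
    then show "x \<in> {m<..m + k}"
    proof induction
      case base
      show ?case using step[of i] wrap i by (cases "i = m + k") auto
    next
      case (step y)
      then show ?case using assms(1)[of y] wrap i by (cases "y = m + k") auto
    qed
  qed
  \<comment> \<open>Successor steps climb from any orbit point of the block to every larger
    one.\<close>
  have up: "b \<in> orbit f i" if "a \<in> orbit f i" "m < a" "a \<le> b" "b \<le> m + k" for a b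
    using that(3,4)
  proof (induction b rule: dec_induct)
    case base
    show ?case by (rule that)
  next
    case (step j)
    then have "f j \<in> orbit f i" by (auto intro: orbit.step)
    then show ?case using step that assms(1)[of j] by simp
  qed
  \<comment> \<open>An orbit is generated from \<open>f i\<close>, and \<open>i\<close> is not yet
    known to belong to it, so the climb starts at \<open>Suc i\<close>.\<close>
  have top: "m + k \<in> orbit f i" if "i < m + k"
    using up[of "Suc i" "m + k"] orbit.base[of f i] step[of i] that i by simp
  \<comment> \<open>Wrapping around from the top reaches the bottom of the block, from which
    \<open>up\<close> covers all of it.\<close>
  have "Suc m \<in> orbit f i"
  proof (cases "i = m + k")
    case True
    then show ?thesis using orbit.base[of f i] wrap by simp
  next
    case False
    then show ?thesis using orbit.step[OF top] wrap i by simp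
  qed
  then show "{m<..m + k} \<subseteq> orbit f i" using up[of "Suc m"] by auto
qed

text \<open>Guarantees that the uniform measure is meaningful and that the class size may be divided
  by. Induction over the parts: a permutation of \<open>{1..m}\<close> realizing the other parts is
  extended by a \<open>k\<close>-cycle on the next \<open>k\<close> numbers.\<close>

lemma conj_class_nonempty: "lam \<turnstile>\<^sub>p n \<Longrightarrow> conj_class n lam \<noteq> {}"
proof (induction lam arbitrary: n)
  case empty
  then have "n = 0" by (simp add: is_partition_def)
  then have "id \<in> conj_class n {#}" by (simp add: conj_class_def cycle_type_def)
  then show ?case by blast
next
  case (add k mu)
  define m where "m = sum_mset mu"
  have k: "k > 0" and n: "n = m + k" and mu: "mu \<turnstile>\<^sub>p m"
    using add.prems by (auto simp: is_partition_def m_def)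
  obtain \<tau> where \<tau>: "\<tau> permutes {1..m}" and type: "cycle_type m \<tau> = mu"
    using add.IH[OF mu] by (auto simp: conj_class_def)
  \<comment> \<open>For \<open>k = 1\<close> the first branch is void and the second makes
    \<open>Suc m\<close> a fixed point.\<close>
  define \<omega> where
    "\<omega> i = (if m < i \<and> i < m + k then Suc i else if i = m + k then Suc m else \<tau> i)" for i
  have low: "\<tau> i \<in> {1..m} \<longleftrightarrow> i \<in> {1..m}" for i using permutes_in_image[OF \<tau>] .
  have agree: "\<omega> i = \<tau> i" if "i \<in> {1..m}" for i using that k by (auto simp: \<omega>_def)
  have top_image: "\<omega> ` {m<..m + k} = {m<..m + k}"
  proof (intro equalityI subsetI)
    fix x assume "x \<in> {m<..m + k}"
    \<comment> \<open>The witness is the inverse shift: the bottom of the block comes from its top,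
      any other point from its predecessor.\<close>
    then show "x \<in> \<omega> ` {m<..m + k}"
      using k by (intro image_eqI[of _ _ "if x = Suc m then m + k else x - 1"])
        (auto simp: \<omega>_def)
  qed (use k in \<open>auto simp: \<omega>_def\<close>)
  have low_image: "\<omega> ` {1..m} = {1..m}"
    using permutes_image[OF \<tau>] agree by (metis image_cong)
  have split: "{1..n} = {1..m} \<union> {m<..m + k}" using n by auto
  have "\<omega> permutes {1..n}"
  proof (rule bij_imp_permutes)
    have "\<omega> ` {1..n} = {1..n}" unfolding split image_Un top_image low_image ..
    then show "bij_betw \<omega> {1..n} {1..n}"
      by (simp add: bij_betw_def finite_surj_inj)
    show "\<omega> i = i" if "i \<notin> {1..n}" for i
      using that n permutes_not_in[OF \<tau>, of i] k by (auto simp: \<omega>_def)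
  qed
  moreover have "cycle_type n \<omega> = add_mset k mu"
  proof -
    have "orbit \<omega> i = orbit \<tau> i" if "i \<in> {1..m}" for i
      using that by (rule orbit_cong0) (use agree low in auto)
    then have orb_low: "orbit \<omega> ` {1..m} = orbit \<tau> ` {1..m}" by (intro image_cong) auto
    have "orbit \<omega> i = {m<..m + k}" if "i \<in> {m<..m + k}" for i
      using that by (intro orbit_shift_interval) (auto simp: \<omega>_def)
    then have orb_top: "orbit \<omega> ` {m<..m + k} = {{m<..m + k}}"
      using k by (auto intro!: image_eqI[of _ _ "m + k"])
    \<comment> \<open>The cycle type is read off a set of orbits, so the new block contributes an
      additional part only if it differs from all old orbits. An old orbit contains some
      \<open>i \<le> m\<close>, which the block does not.\<close>
    have "{m<..m + k} \<notin> orbit \<tau> ` {1..m}"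
    proof
      assume "{m<..m + k} \<in> orbit \<tau> ` {1..m}"
      then obtain i where i: "i \<in> {1..m}" "{m<..m + k} = orbit \<tau> i" by auto
      have "i \<in> orbit \<tau> i"
        by (rule permutation_self_in_orbit[OF permutes_interval_permutation[OF \<tau>]])
      then show False using i by (metis atLeastAtMost_iff greaterThanAtMost_iff not_le)
    qed
    then show ?thesis
      unfolding cycle_type_def split image_Un orb_low orb_top
      using type by (simp add: cycle_type_def)
  qed
  ultimately show ?case by (auto simp: conj_class_def)
qed

lemma expect_class_eq_average:
  assumes "lam \<turnstile>\<^sub>p n"
  shows "expect_class n lam X
    = real (\<Sum>\<omega>\<in>conj_class n lam. X \<omega>) / real (card (conj_class n lam))"
  unfolding expect_class_def
  by (simp add: integral_pmf_of_set[OF conj_class_nonempty[OF assms] finite_conj_class])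

theorem theorem5p1:
  fixes n :: nat and lam :: "nat multiset"
  assumes "lam \<turnstile>\<^sub>p n"
  shows "expect_class n lam (exc n) = 1 / 2 * (real n - real (count lam 1)) \<and>
         expect_class n lam (aexc n) = 1 / 2 * (real n - real (count lam 1)) \<and>
         expect_class n lam (wexc n) = 1 / 2 * (real n + real (count lam 1))"
proof -
  let ?C = "conj_class n lam"
  let ?e = "\<Sum>\<omega>\<in>?C. exc n \<omega>" and ?w = "\<Sum>\<omega>\<in>?C. wexc n \<omega>" and ?a = "count lam 1"
  have c: "real (card ?C) > 0"
    using conj_class_nonempty[OF assms] finite_conj_class by (simp add: card_gt_0_iff)
  have fixed: "card {i \<in> {1..n}. \<omega> i = i} = ?a" if "\<omega> \<in> ?C" for \<omega>
    using that count_cycle_type_one by (auto simp: conj_class_def)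
  \<comment> \<open>Summing the trichotomy over the class, where the number of fixed points is the
    constant \<open>?a\<close>, determines \<open>?e\<close> because the two excedance sums agree.
    Additive form avoids truncated subtraction on \<open>nat\<close>.\<close>
  have "?e + (\<Sum>\<omega>\<in>?C. aexc n \<omega>) + card ?C * ?a
      = (\<Sum>\<omega>\<in>?C. exc n \<omega> + aexc n \<omega> + card {i \<in> {1..n}. \<omega> i = i})"
    using fixed by (simp add: sum.distrib)
  also have "\<dots> = card ?C * n" by (simp only: exc_aexc_fixed(1) sum_constant of_nat_id)
  finally have "2 * ?e + card ?C * ?a = card ?C * n" by (simp add: sum_exc_eq_sum_aexc)
  \<comment> \<open>Removing \<open>of_nat_sum\<close> keeps \<open>real ?e\<close> as one atom, in
    the form in which the averages below contain it.\<close>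
  from arg_cong[OF this, of real] have e: "2 * real ?e = real (card ?C) * (real n - real ?a)"
    by (simp add: algebra_simps del: of_nat_sum)
  have "?w = ?e + card ?C * ?a"
    using fixed by (simp add: exc_aexc_fixed(2) sum.distrib)
  from arg_cong[OF this, of real] e
  have w: "2 * real ?w = real (card ?C) * (real n + real ?a)"
    by (simp add: algebra_simps del: of_nat_sum)
  show ?thesis
    unfolding expect_class_eq_average[OF assms] sum_exc_eq_sum_aexc[symmetric]
    using c e w by (simp add: field_simps del: of_nat_sum)
qed

end
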